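(* For all $u,v\in\mathcal{A}$, $$\partial(u\mathbin{ш}v)=(\partial u)\mathbin{ш}v+u\mathbin{ш}(\partial v),$$ where $\mathbin{ш}$ denotes the shuffle product on $\mathcal{A}$.
   Context: Let $F$ be a field and let $\mathcal{A}=\mathcal{A}_F$ be the non-commutative free (unital, associative) algebra over $\mathbb{Z}$ generated by the indeterminates $\{e_p\mid p\in F\}$. Fix a group homomorphism $\mathfrak{F}:F^\times\to\mathbb{Z}$ (from the multiplicative group of $F$ to the additive group $\mathbb{Z}$), and for $x\in F$ put $[x]=\mathfrak{F}(x)$ if $x\neq0$ and $[0]=0$. For $s,t\in F$, the $\mathbb{Z}$-linear map $\partial^{s,t}:\mathcal{A}\to\mathcal{A}$ is defined on monomials by $$\partial^{s,t}(e_{a_1}\cdots e_{a_n})=\sum_{i=1}^n\left([a_{i+1}-a_i]-[a_i-a_{i-1}]\right)e_{a_1}\cdots\widehat{e_{a_i}}\cdots e_{a_n},\qquad (a_0,a_{n+1})=(s,t),$$ where the hat means that the factor is omitted (so $\partial^{s,t}(1)=0$). Put $\partial=\partial^{0,1}$. The shuffle product $\mathbin{ш}:\mathcal{A}\times\mathcal{A}\to\mathcal{A}$ is the $\mathbb{Z}$-bilinear map defined inductively by $w\mathbin{ш}1=1\mathbin{ш}w=w$ for $w\in\mathcal{A}$ and $e_au\mathbin{ш}e_bv=e_a(u\mathbin{ш}e_bv)+e_b(e_au\mathbin{ш}v)$ for $a,b\in F$, $u,v\in\mathcal{A}$. *)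

theory Defs
  imports Complex_Main "HOL-Library.Poly_Mapping"
begin

text \<open>
  Words over \<open>'a\<close> are wrapped in a datatype to make them a (multiplicatively free, additively
  written) monoid. The convolution product of \<^theory>\<open>HOL-Library.Poly_Mapping\<close> then turns
  \<open>'a fword \<Rightarrow>\<^sub>0 int\<close> into the free unital associative ring on the generators \<open>gen p\<close>.
\<close>

datatype 'a fword = Word (letters: "'a list")

instantiation fword :: (type) monoid_add
begin

definition zero_fword :: "'a fword" where
  "0 = Word []"

definition plus_fword :: "'a fword \<Rightarrow> 'a fword \<Rightarrow> 'a fword" where
  "u + v = Word (letters u @ letters v)"

instance
  by standard (simp_all add: zero_fword_def plus_fword_def)

end

type_synonym 'a free_alg = "'a fword \<Rightarrow>\<^sub>0 int"

definition gen :: "'a \<Rightarrow> 'a free_alg" where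
  "gen p = frag_of (Word [p])"

definition monom :: "'a list \<Rightarrow> 'a free_alg" where
  "monom as = prod_list (map gen as)"

lemma monom_eq_frag_of: "monom as = frag_of (Word as)"
proof (induction as)
  case Nil
  show ?case
    by (simp add: monom_def flip: zero_fword_def)
next
  case (Cons a as)
  then show ?case
    by (simp add: monom_def gen_def mult_single plus_fword_def)
qed

text \<open>\<open>\<FF>\<close> stands for a homomorphism from the unit group of the field; its value at \<open>0\<close> is
  not used.\<close>

definition bracket :: "('f::field \<Rightarrow> int) \<Rightarrow> 'f \<Rightarrow> int" where
  "bracket \<FF> x = (if x = 0 then 0 else \<FF> x)"

text \<open>In \<open>b = [s, a\<^sub>1, \<dots>, a\<^sub>n, t]\<close> the entry \<open>b ! i\<close> is \<open>a\<^sub>i\<close> for \<open>0 \<le> i \<le> n + 1\<close>, whereas the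
  list \<open>as = [a\<^sub>1, \<dots>, a\<^sub>n]\<close> itself is indexed from \<open>0\<close>.\<close>

definition partial_monom :: "('f::field \<Rightarrow> int) \<Rightarrow> 'f \<Rightarrow> 'f \<Rightarrow> 'f list \<Rightarrow> 'f free_alg" where
  "partial_monom \<FF> s t as =
     (let b = s # as @ [t] in
      \<Sum>i = 1..length as.
        frag_cmul (bracket \<FF> (b ! (i + 1) - b ! i) - bracket \<FF> (b ! i - b ! (i - 1)))
          (monom (take (i - 1) as @ drop i as)))"

definition partial_st :: "('f::field \<Rightarrow> int) \<Rightarrow> 'f \<Rightarrow> 'f \<Rightarrow> 'f free_alg \<Rightarrow> 'f free_alg" where
  "partial_st \<FF> s t = frag_extend (\<lambda>w. partial_monom \<FF> s t (letters w))"

definition partial :: "('f::field \<Rightarrow> int) \<Rightarrow> 'f free_alg \<Rightarrow> 'f free_alg" where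
  "partial \<FF> = partial_st \<FF> 0 1"

fun shuffle_words :: "'a list \<Rightarrow> 'a list \<Rightarrow> 'a free_alg" where
  "shuffle_words [] bs = monom bs"
| "shuffle_words (a # as) [] = monom (a # as)"
| "shuffle_words (a # as) (b # bs) =
     gen a * shuffle_words as (b # bs) + gen b * shuffle_words (a # as) bs"

definition shuffle :: "'a free_alg \<Rightarrow> 'a free_alg \<Rightarrow> 'a free_alg" where
  "shuffle u v =
     frag_extend (\<lambda>x. frag_extend (\<lambda>y. shuffle_words (letters x) (letters y)) v) u"

lemma partial_st_monom: "partial_st \<FF> s t (monom as) = partial_monom \<FF> s t as"
  by (simp add: partial_st_def monom_eq_frag_of)

lemma partial_st_add: "partial_st \<FF> s t (u + v) = partial_st \<FF> s t u + partial_st \<FF> s t v"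
  by (simp add: partial_st_def frag_extend_add)

lemma shuffle_monom: "shuffle (monom as) (monom bs) = shuffle_words as bs"
  by (simp add: shuffle_def monom_eq_frag_of)

lemma shuffle_add_left: "shuffle (u + u') v = shuffle u v + shuffle u' v"
  by (simp add: shuffle_def frag_extend_add)

lemma shuffle_add_right: "shuffle u (v + v') = shuffle u v + shuffle u v'"
  unfolding shuffle_def frag_extend_add
  by (simp add: frag_extend_def[where x = u] frag_cmul_distrib2 sum.distrib)

lemma shuffle_diff_left: "shuffle (u - u') v = shuffle u v - shuffle u' v"
  by (metis add_diff_cancel_right' diff_add_cancel shuffle_add_left)

lemma shuffle_diff_right: "shuffle u (v - v') = shuffle u v - shuffle u v'"
  by (metis add_diff_cancel_right' diff_add_cancel shuffle_add_right)

lemma shuffle_zero [simp]: "shuffle 0 v = 0" "shuffle u 0 = 0"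
  using shuffle_diff_left[of 0 0 v] shuffle_diff_right[of u 0 0] by simp_all

lemma free_alg_induct [case_names zero monom diff]:
  assumes "P 0" "\<And>as. P (monom as)" "\<And>u v. P u \<Longrightarrow> P v \<Longrightarrow> P (u - v)"
  shows "P (u :: 'a free_alg)"
proof (rule frag_induction[where S = UNIV])
  show "P (frag_of w)" for w
    using assms(2)[of "letters w"] by (simp add: monom_eq_frag_of)
qed (use assms in auto)

lemma shuffle_1_left: "shuffle 1 v = v"
proof (induction v rule: free_alg_induct)
  case (monom bs)
  show ?case
    using shuffle_monom[of "[]" bs] by (simp add: monom_def)
qed (simp_all add: shuffle_diff_right)

lemma shuffle_1_right: "shuffle u 1 = u"
proof (induction u rule: free_alg_induct)
  case (monom as)
  show ?case
    using shuffle_monom[of as "[]"] by (cases as) (simp_all add: monom_def)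
qed (simp_all add: shuffle_diff_left)

lemma shuffle_gen_mult:
  "shuffle (gen a * u) (gen b * v) =
     gen a * shuffle u (gen b * v) + gen b * shuffle (gen a * u) v"
proof (induction u rule: free_alg_induct)
  case (monom as)
  show ?case
  proof (induction v rule: free_alg_induct)
    case (monom bs)
    show ?case
      using shuffle_monom[of "a # as" "b # bs"] shuffle_monom[of as "b # bs"]
        shuffle_monom[of "a # as" bs]
      by (simp add: monom_def)
  qed (simp_all add: shuffle_diff_right right_diff_distrib)
qed (simp_all add: shuffle_diff_left right_diff_distrib)

end

theory Submission
  imports Defs
begin

text \<open>
  The map \<^term>\<open>partial_st \<FF> s t\<close> is a derivation of the shuffle product for every choice of the end
  points \<open>s\<close> and \<open>t\<close>; write \<open>\<partial>\<^sup>s\<close> for it, with \<open>t\<close> fixed. The generality in \<open>s\<close> is what makes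
  induction on the words possible. Splitting off the first letter gives
  \<open>\<partial>\<^sup>s (e\<^sub>a w) = e\<^sub>a \<partial>\<^sup>a w + N\<^sub>a w - [a - s] w\<close>, in which the start point of the inner derivative has
  moved from \<open>s\<close> to \<open>a\<close>; here \<open>N\<^sub>a\<close> multiplies each word by \<open>[b - a]\<close>, where \<open>b\<close> is its first
  letter (\<open>t\<close> for the empty word), see \<open>partial_st_gen_mult\<close>. In particular,
  \<open>\<partial>\<^sup>a (e\<^sub>b w) = \<partial>\<^sup>s (e\<^sub>b w) + ([b - s] - [b - a]) w\<close>, so that a change of the start point costs only a
  multiple of the word without its first letter.

  Apply this to \<open>u = e\<^sub>a u'\<close> and \<open>v = e\<^sub>b v'\<close>, whose shuffle product is the sum of \<open>e\<^sub>a\<close> times the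
  product of \<open>u'\<close> and \<open>v\<close>, and \<open>e\<^sub>b\<close> times the product of \<open>u\<close> and \<open>v'\<close>. The induction hypothesis
  for the start points \<open>a\<close> and \<open>b\<close>, followed by the change of start point back to \<open>s\<close>, yields the
  right-hand side of the Leibniz rule together with error terms. Writing \<open>x\<close> for the shuffle product
  of \<open>u'\<close> and \<open>v'\<close>, the scalar errors are
  \<open>[b - s] e\<^sub>a x - [a - s] e\<^sub>b x + [b - a] (e\<^sub>b x - e\<^sub>a x)\<close> from the first summand
  (\<open>partial_st_shuffle_half\<close>) and the same expression with \<open>a\<close> and \<open>b\<close> exchanged from the second.
  The sum of the two is \<open>([b - a] - [a - b]) (e\<^sub>b x - e\<^sub>a x)\<close>, which vanishes because the bracket is
  even: a homomorphism into the torsion-free group of integers sends \<open>-1\<close> to \<open>0\<close>.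
\<close>

lemma bracket_minus:
  fixes \<FF> :: "'f::field \<Rightarrow> int"
  assumes hom: "\<And>x y. x \<noteq> 0 \<Longrightarrow> y \<noteq> 0 \<Longrightarrow> \<FF> (x * y) = \<FF> x + \<FF> y"
  shows "bracket \<FF> (- x) = bracket \<FF> x"
proof -
  have "\<FF> 1 = 0"
    using hom[of 1 1] by simp
  then have "\<FF> (- 1) = 0"
    using hom[of "- 1" "- 1"] by simp
  then show ?thesis
    using hom[of "- 1" x] by (simp add: bracket_def)
qed

lemma monom_Nil: "monom [] = 1"
  and monom_Cons: "monom (a # as) = gen a * monom as"
  by (simp_all add: monom_def)

lemma partial_st_diff: "partial_st \<FF> s t (u - v) = partial_st \<FF> s t u - partial_st \<FF> s t v"
  by (simp add: partial_st_def frag_extend_diff)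

lemma partial_st_0 [simp]: "partial_st \<FF> s t 0 = 0"
  by (simp add: partial_st_def)

lemma partial_st_1 [simp]: "partial_st \<FF> s t 1 = 0"
  using partial_st_monom[of \<FF> s t "[]"] by (simp add: monom_Nil partial_monom_def)

lemma frag_cmul_diff_distrib2: "frag_cmul c (u - v) = frag_cmul c u - frag_cmul c v"
  by (metis add_diff_cancel_right' diff_add_cancel frag_cmul_distrib2)

lemma mult_frag_cmul_right: "x * frag_cmul c y = frag_cmul c (x * y)" for x y :: "'a free_alg"
proof -
  have nat: "x * frag_cmul (int n) y = frag_cmul (int n) (x * y)" for n
    by (induction n) (simp_all add: frag_cmul_distrib distrib_left)
  show ?thesis
    by (cases c rule: int_diff_cases) (simp add: frag_cmul_diff_distrib right_diff_distrib nat)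
qed

lemma shuffle_frag_cmul_left: "shuffle (frag_cmul c u) v = frag_cmul c (shuffle u v)"
  by (simp add: shuffle_def frag_extend_cmul)

lemma shuffle_frag_cmul_right: "shuffle u (frag_cmul c v) = frag_cmul c (shuffle u v)"
proof (induction u rule: free_alg_induct)
  case (monom as)
  show ?case
    by (simp add: shuffle_def monom_eq_frag_of frag_extend_cmul)
qed (simp_all add: shuffle_diff_left frag_cmul_diff_distrib2)

text \<open>The operator \<open>N\<^sub>a\<close>. The first letter of a word is read off after the end point \<open>t\<close> has been
  appended, since \<open>t\<close> is the right neighbour of \<open>a\<close> in the one-letter word \<open>e\<^sub>a\<close>.\<close>

definition head_weight :: "('f::field \<Rightarrow> int) \<Rightarrow> 'f \<Rightarrow> 'f \<Rightarrow> 'f free_alg \<Rightarrow> 'f free_alg" where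
  "head_weight \<FF> a t =
     frag_extend (\<lambda>w. frag_cmul (bracket \<FF> (hd (letters w @ [t]) - a)) (frag_of w))"

lemma head_weight_monom:
  "head_weight \<FF> a t (monom as) = frag_cmul (bracket \<FF> (hd (as @ [t]) - a)) (monom as)"
  by (simp add: head_weight_def monom_eq_frag_of)

lemma head_weight_add:
  "head_weight \<FF> a t (u + v) = head_weight \<FF> a t u + head_weight \<FF> a t v"
  by (simp add: head_weight_def frag_extend_add)

lemma head_weight_diff:
  "head_weight \<FF> a t (u - v) = head_weight \<FF> a t u - head_weight \<FF> a t v"
  by (simp add: head_weight_def frag_extend_diff)

lemma head_weight_0 [simp]: "head_weight \<FF> a t 0 = 0"
  by (simp add: head_weight_def)

lemma head_weight_gen_mult:
  "head_weight \<FF> a t (gen b * x) = frag_cmul (bracket \<FF> (b - a)) (gen b * x)"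
proof (induction x rule: free_alg_induct)
  case (monom as)
  show ?case
    by (simp add: head_weight_monom flip: monom_Cons)
qed (simp_all add: right_diff_distrib head_weight_diff frag_cmul_diff_distrib2)

text \<open>Deleting the first letter \<open>a\<close> gives the scalar multiple of \<open>as\<close>; every other deletion keeps \<open>a\<close>,
  which then plays the role of the start point for the rest of the word.\<close>

lemma partial_monom_Cons:
  "partial_monom \<FF> s t (a # as) =
     gen a * partial_monom \<FF> a t as
     + frag_cmul (bracket \<FF> (hd (as @ [t]) - a) - bracket \<FF> (a - s)) (monom as)"
proof -
  define b where "b = s # a # as @ [t]"
  define f where "f i = frag_cmul (bracket \<FF> (b ! (i + 1) - b ! i) - bracket \<FF> (b ! i - b ! (i - 1)))
    (monom (take (i - 1) (a # as) @ drop i (a # as)))" for i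
  define g where "g i = frag_cmul (bracket \<FF> ((a # as @ [t]) ! (i + 1) - (a # as @ [t]) ! i)
      - bracket \<FF> ((a # as @ [t]) ! i - (a # as @ [t]) ! (i - 1)))
    (monom (take (i - 1) as @ drop i as))" for i
  have "partial_monom \<FF> s t (a # as) = sum f {1..Suc (length as)}"
    by (simp add: partial_monom_def f_def b_def Let_def)
  also have "\<dots> = f 1 + sum f {Suc 1..Suc (length as)}"
    by (rule sum.atLeast_Suc_atMost) simp
  also have "sum f {Suc 1..Suc (length as)} = (\<Sum>i = 1..length as. f (Suc i))"
    by (rule sum.shift_bounds_cl_Suc_ivl)
  also have "\<dots> = (\<Sum>i = 1..length as. gen a * g i)"
  proof (rule sum.cong)
    fix i assume "i \<in> {1..length as}"
    then obtain j where "i = Suc j"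
      by (cases i) auto
    then show "f (Suc i) = gen a * g i"
      by (simp add: f_def g_def b_def mult_frag_cmul_right monom_Cons)
  qed simp
  also have "\<dots> = gen a * partial_monom \<FF> a t as"
    by (simp add: partial_monom_def g_def Let_def sum_distrib_left)
  also have "f 1 = frag_cmul (bracket \<FF> (hd (as @ [t]) - a) - bracket \<FF> (a - s)) (monom as)"
    by (cases as) (simp_all add: f_def b_def)
  finally show ?thesis
    by (simp add: add.commute)
qed

lemma partial_st_gen_mult:
  "partial_st \<FF> s t (gen a * x) =
     gen a * partial_st \<FF> a t x + head_weight \<FF> a t x - frag_cmul (bracket \<FF> (a - s)) x"
proof (induction x rule: free_alg_induct)
  case (monom as)
  have "partial_st \<FF> s t (gen a * monom as) = partial_monom \<FF> s t (a # as)"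
    by (simp add: partial_st_monom flip: monom_Cons)
  then show ?case
    by (simp add: partial_st_monom partial_monom_Cons head_weight_monom frag_cmul_diff_distrib)
qed (simp_all add: right_diff_distrib partial_st_diff head_weight_diff frag_cmul_diff_distrib2)

lemma partial_st_change_start:
  "partial_st \<FF> a t (gen b * x) =
     partial_st \<FF> s t (gen b * x) + frag_cmul (bracket \<FF> (b - s) - bracket \<FF> (b - a)) x"
  by (simp add: partial_st_gen_mult frag_cmul_diff_distrib)

text \<open>A term of the shuffle product of a word \<open>u\<close> and a word starting with \<open>b\<close> starts either with \<open>b\<close>
  or with the first letter of \<open>u\<close>. The terms of the latter kind are isolated by subtraction, which
  also covers the empty \<open>u\<close>: there the difference vanishes, so its weight does not matter.\<close>

lemma head_weight_shuffle:
  "head_weight \<FF> a t (shuffle (monom as) (gen b * y)) =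
     frag_cmul (bracket \<FF> (hd (as @ [t]) - a))
       (shuffle (monom as) (gen b * y) - gen b * shuffle (monom as) y)
     + frag_cmul (bracket \<FF> (b - a)) (gen b * shuffle (monom as) y)"
proof (cases as)
  case Nil
  then show ?thesis
    by (simp add: monom_Nil shuffle_1_left head_weight_gen_mult)
next
  case (Cons c cs)
  then show ?thesis
    by (simp add: monom_Cons shuffle_gen_mult head_weight_add head_weight_gen_mult)
qed

text \<open>Commutativity of the shuffle product makes one computation serve for both of its recursive
  summands.\<close>

lemma shuffle_commute: "shuffle u v = shuffle v u"
proof -
  have words: "shuffle (monom as) (monom bs) = shuffle (monom bs) (monom as)" for as bs :: "'a list"
    by (induction as bs rule: shuffle_words.induct)
      (simp_all add: monom_Nil monom_Cons shuffle_1_left shuffle_1_right shuffle_gen_mult add.commute)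
  show ?thesis
  proof (induction u rule: free_alg_induct)
    case (monom as)
    show ?case
      by (induction v rule: free_alg_induct)
        (simp_all add: words shuffle_diff_left shuffle_diff_right)
  qed (simp_all add: shuffle_diff_left shuffle_diff_right)
qed

text \<open>One half of the derivative of the shuffle product of \<open>e\<^sub>a as\<close> and \<open>e\<^sub>b y\<close>, namely that of the
  terms starting with \<open>a\<close>. The Leibniz rule for the remaining factors is assumed at the start point
  \<open>a\<close>, the letter split off. The result is arranged so that for an even bracket everything after the
  first summand changes sign when \<open>(a, as)\<close> is exchanged with the letters of the other factor; the
  two halves then add up to the Leibniz rule.\<close>

lemma partial_st_shuffle_half:
  assumes leibniz: "partial_st \<FF> a t (shuffle (monom as) (gen b * y)) =
      shuffle (partial_st \<FF> a t (monom as)) (gen b * y)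
      + shuffle (monom as) (partial_st \<FF> a t (gen b * y))"
  shows "partial_st \<FF> s t (gen a * shuffle (monom as) (gen b * y)) =
      shuffle (partial_st \<FF> s t (gen a * monom as)) (gen b * y)
      + (gen a * shuffle (monom as) (partial_st \<FF> s t (gen b * y))
         - gen b * shuffle (partial_st \<FF> s t (gen a * monom as)) y)
      + frag_cmul (bracket \<FF> (b - s) - bracket \<FF> (b - a)) (gen a * shuffle (monom as) y)
      - frag_cmul (bracket \<FF> (a - s) - bracket \<FF> (b - a)) (gen b * shuffle (monom as) y)"
proof -
  define h where "h = bracket \<FF> (hd (as @ [t]) - a)"
  define v where "v = gen b * y"
  define d where "d = partial_st \<FF> a t (monom as)"
  have u: "partial_st \<FF> s t (gen a * monom as) =
      gen a * d + frag_cmul (h - bracket \<FF> (a - s)) (monom as)"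
    by (simp add: partial_st_gen_mult head_weight_monom frag_cmul_diff_distrib h_def d_def)
  have left: "shuffle (partial_st \<FF> s t (gen a * monom as)) v =
      gen a * shuffle d v + gen b * shuffle (gen a * d) y
      + frag_cmul (h - bracket \<FF> (a - s)) (shuffle (monom as) v)"
    by (simp add: u v_def shuffle_add_left shuffle_frag_cmul_left shuffle_gen_mult)
  have tail: "gen b * shuffle (partial_st \<FF> s t (gen a * monom as)) y =
      gen b * shuffle (gen a * d) y
      + frag_cmul (h - bracket \<FF> (a - s)) (gen b * shuffle (monom as) y)"
    by (simp add: u shuffle_add_left shuffle_frag_cmul_left distrib_left mult_frag_cmul_right)
  have moved: "partial_st \<FF> a t v =
      partial_st \<FF> s t v + frag_cmul (bracket \<FF> (b - s) - bracket \<FF> (b - a)) y"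
    unfolding v_def by (rule partial_st_change_start)
  have head: "head_weight \<FF> a t (shuffle (monom as) v) =
      frag_cmul h (shuffle (monom as) v - gen b * shuffle (monom as) y)
      + frag_cmul (bracket \<FF> (b - a)) (gen b * shuffle (monom as) y)"
    unfolding v_def h_def by (rule head_weight_shuffle)
  have "partial_st \<FF> s t (gen a * shuffle (monom as) v) =
      gen a * (shuffle d v + shuffle (monom as) (partial_st \<FF> a t v))
      + head_weight \<FF> a t (shuffle (monom as) v)
      - frag_cmul (bracket \<FF> (a - s)) (shuffle (monom as) v)"
    using leibniz by (simp add: partial_st_gen_mult v_def d_def)
  then show ?thesis
    unfolding v_def[symmetric] left tail moved head
    by (simp add: shuffle_add_right shuffle_diff_right shuffle_frag_cmul_right distrib_left
        right_diff_distrib mult_frag_cmul_right frag_cmul_diff_distrib frag_cmul_diff_distrib2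
        del: minus_frag_cmul flip: minus_frag_cmul)
qed

lemma partial_st_shuffle_monom:
  assumes even: "\<And>x. bracket \<FF> (- x) = bracket \<FF> x"
  shows "partial_st \<FF> s t (shuffle (monom as) (monom bs)) =
    shuffle (partial_st \<FF> s t (monom as)) (monom bs)
    + shuffle (monom as) (partial_st \<FF> s t (monom bs))"
proof (induction as bs arbitrary: s rule: shuffle_words.induct)
  case (1 bs)
  show ?case
    by (simp add: monom_Nil shuffle_1_left)
next
  case (2 a as)
  show ?case
    by (simp add: monom_Nil shuffle_1_right)
next
  case (3 a as b bs)
  have left: "partial_st \<FF> a t (shuffle (monom as) (gen b * monom bs)) =
      shuffle (partial_st \<FF> a t (monom as)) (gen b * monom bs)
      + shuffle (monom as) (partial_st \<FF> a t (gen b * monom bs))"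
    using "3.IH"(1) by (simp add: monom_Cons)
  have right: "partial_st \<FF> b t (shuffle (monom bs) (gen a * monom as)) =
      shuffle (partial_st \<FF> b t (monom bs)) (gen a * monom as)
      + shuffle (monom bs) (partial_st \<FF> b t (gen a * monom as))"
    using "3.IH"(2)[of b] by (simp add: monom_Cons shuffle_commute add.commute)
  have sym: "bracket \<FF> (a - b) = bracket \<FF> (b - a)"
    using even[of "b - a"] by simp
  have "partial_st \<FF> s t (gen b * shuffle (gen a * monom as) (monom bs)) =
      shuffle (gen a * monom as) (partial_st \<FF> s t (gen b * monom bs))
      + (gen b * shuffle (partial_st \<FF> s t (gen a * monom as)) (monom bs)
         - gen a * shuffle (monom as) (partial_st \<FF> s t (gen b * monom bs)))
      + frag_cmul (bracket \<FF> (a - s) - bracket \<FF> (b - a)) (gen b * shuffle (monom as) (monom bs))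
      - frag_cmul (bracket \<FF> (b - s) - bracket \<FF> (b - a)) (gen a * shuffle (monom as) (monom bs))"
    using partial_st_shuffle_half[OF right, of s] by (simp add: sym shuffle_commute)
  then have "partial_st \<FF> s t (shuffle (gen a * monom as) (gen b * monom bs)) =
      shuffle (partial_st \<FF> s t (gen a * monom as)) (gen b * monom bs)
      + shuffle (gen a * monom as) (partial_st \<FF> s t (gen b * monom bs))"
    by (simp add: shuffle_gen_mult partial_st_add partial_st_shuffle_half[OF left])
  then show ?case
    by (simp add: monom_Cons)
qed

theorem theorem3:
  fixes \<FF> :: "'f::field \<Rightarrow> int"
    and u v :: "'f free_alg"
  assumes "\<And>x y. x \<noteq> 0 \<Longrightarrow> y \<noteq> 0 \<Longrightarrow> \<FF> (x * y) = \<FF> x + \<FF> y"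
  shows "partial \<FF> (shuffle u v) = shuffle (partial \<FF> u) v + shuffle u (partial \<FF> v)"
  unfolding partial_def
proof (induction u rule: free_alg_induct)
  case (monom as)
  show ?case
  proof (induction v rule: free_alg_induct)
    case (monom bs)
    show ?case
      by (rule partial_st_shuffle_monom) (rule bracket_minus[OF assms])
  qed (simp_all add: shuffle_diff_right partial_st_diff)
qed (simp_all add: shuffle_diff_left partial_st_diff)

end
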